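(* Let $X=(X_t)_{t\ge 0}$ and $Y=(Y_t)_{t\ge 0}$ be stochastic processes with values in $E=\{e_1,\dots,e_n\}$ and $F=\{f_1,\dots,f_m\}$ respectively. If $(X,Y)$ is time homogeneous and belongs both to $\Sigma_P$ and to $\Sigma_S$, then $(X,Y)$ is a hidden Markov chain; conversely, if $(X,Y)$ is a hidden Markov chain, then it is time homogeneous and belongs both to $\Sigma_P$ and to $\Sigma_S$.
   Context: All random variables live on a probability space $(\Omega,\mathcal{F},P)$. $e_1,\dots,e_n$ are the standard basis vectors of $\mathbb{R}^n$ and $f_1,\dots,f_m$ those of $\mathbb{R}^m$; $\otimes$ is the Kronecker product, $I_n$ the identity matrix, $\mathbf{1}_m$ the column vector of $m$ ones. For a process $\zeta$, $\mathcal{F}^\zeta_t=\sigma(\zeta_s: s\le t)$ and $\mathcal{F}^{\zeta+}_t=\sigma(\zeta_s: s\ge t)$. $(X,Y)\in\Sigma_P$ means: for all $t\ge0$ the $\sigma$-algebras $\mathcal{F}^{X+}_{t+1}\vee\mathcal{F}^{Y+}_{t+1}$ and $\mathcal{F}^X_t\vee\mathcal{F}^Y_t$ are conditionally independent given $\sigma(X_t)$. $(X,Y)\in\Sigma_S$ means: for all $t\ge0$ the $\sigma$-algebras $\mathcal{F}^{X+}_{t}\vee\mathcal{F}^{Y+}_{t}$ and $\mathcal{F}^X_{t-1}\vee\mathcal{F}^Y_{t-1}$ are conditionally independent given $\sigma(X_t)$ (with $\mathcal{F}^X_{-1}\vee\mathcal{F}^Y_{-1}$ trivial). Put $\mathcal{F}_t=\sigma\{X_0,\dots,X_t,Y_0,\dots,Y_t\}$,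 $\mathcal{G}_t=\sigma\{X_0,\dots,X_t,Y_0,\dots,Y_{t-1}\}$, $Z_t=Y_t\otimes X_t$ for $t\ge0$, and $W_t=Y_{t-1}\otimes X_t$ for $t\ge1$. Time homogeneous (for a pair in $\Sigma_P\cap\Sigma_S$) means that the transition probabilities of the chains $Z$ and $W$, which depend on $X$ only, do not depend on time: there are matrices $\bar Q,\bar R\in\mathbb{R}^{nm\times n}$, independent of $t$, with $E[Z_{t+1}|\mathcal{F}_t]=\bar Q X_t$ a.s. for all $t\ge0$ and $E[W_{t+1}|\mathcal{G}_t]=\bar R X_t$ a.s. for all $t\ge1$. $(X,Y)$ is a hidden Markov chain if $Z$ is Markov with respect to $\{\mathcal{F}_t\}$ with matrix of transition probabilities of the form $Q=\Delta(G)A(\mathbf{1}_m^\top\otimes I_n)$, i.e. there are $A\in\mathbb{R}^{n\times n}$ and $G\in\mathbb{R}^{m\times n}$, both with nonnegative entries and columns summing to one, such that $E[Z_{t+1}|\mathcal{F}_t]=QZ_t=\Delta(G)AX_t$ a.s. for all $t\ge0$. Here, for $G$ with rows $G_{1\cdot},\dots,G_{m\cdot}$, $\Delta(G)\in\mathbb{R}^{nm\times n}$ is obtained by stacking the $n\times n$ diagonal matrices $\mathrm{diag}(G_{1\cdot}),\dots,\mathrm{diag}(G_{m\cdot})$ one underneath the other. *)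

theory Defs
  imports "HOL-Probability.Probability"
begin

section \<open>Sigma-algebras generated by processes\<close>

text \<open>
  Sub-sigma-algebras of \<open>M\<close> are represented by measure spaces over \<open>space M\<close> of which only the
  underlying measurable space matters, as expected by \<^const>\<open>real_cond_exp\<close>.
  For \<open>I = {}\<close> the generated sigma-algebra is the trivial one; in particular index sets \<open>{..<t}\<close>
  encode the past up to time \<open>t - 1\<close> with the right convention at \<open>t = 0\<close>.
\<close>

definition gen_alg :: "'a measure \<Rightarrow> nat set \<Rightarrow> (nat \<Rightarrow> 'a \<Rightarrow> 'b::topological_space) \<Rightarrow> 'a measure"
  where "gen_alg M I \<zeta> = sigma (space M) (\<Union>s\<in>I. {\<zeta> s -` B \<inter> space M | B. B \<in> sets borel})"

definition join_alg :: "'a measure \<Rightarrow> 'a measure \<Rightarrow> 'a measure"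
  where "join_alg A B = sigma (space A \<union> space B) (sets A \<union> sets B)"

definition cond_indep_alg :: "'a measure \<Rightarrow> 'a measure \<Rightarrow> 'a measure \<Rightarrow> 'a measure \<Rightarrow> bool"
  where "cond_indep_alg M A B H \<longleftrightarrow>
    (\<forall>a\<in>sets A. \<forall>b\<in>sets B. AE \<omega> in M.
       real_cond_exp M H (indicator (a \<inter> b)) \<omega> =
       real_cond_exp M H (indicator a) \<omega> * real_cond_exp M H (indicator b) \<omega>)"

definition vec_cond_exp :: "'a measure \<Rightarrow> 'a measure \<Rightarrow> ('a \<Rightarrow> real ^ 'k) \<Rightarrow> 'a \<Rightarrow> real ^ 'k"
  where "vec_cond_exp M H f = (\<lambda>\<omega>. \<chi> i. real_cond_exp M H (\<lambda>\<omega>. f \<omega> $ i) \<omega>)"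


section \<open>Kronecker products\<close>

text \<open>
  \<open>\<real>\<^sup>n\<^sup>m\<close> is indexed by pairs \<open>(j, i)\<close>, where \<open>j\<close> is the block and \<open>i\<close> the position inside the
  block, i.e. \<open>(j, i)\<close> stands for the index \<open>(j - 1) n + i\<close>.
\<close>

definition kron :: "real ^ 'm \<Rightarrow> real ^ 'n \<Rightarrow> real ^ ('m \<times> 'n)"
  where "kron y x = (\<chi> p. y $ fst p * x $ snd p)"

text \<open>\<open>row_kron v B\<close> is the block row matrix \<open>v\<^sup>T \<otimes> B\<close>.\<close>

definition row_kron :: "real ^ 'm \<Rightarrow> real ^ 'l ^ 'k \<Rightarrow> real ^ ('m \<times> 'l) ^ 'k"
  where "row_kron v B = (\<chi> k p. v $ fst p * B $ k $ snd p)"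

text \<open>\<open>diag_stack G\<close> is \<open>\<Delta>(G)\<close>: the diagonal matrices of the rows of \<open>G\<close>, stacked.\<close>

definition diag_stack :: "real ^ 'n ^ 'm \<Rightarrow> real ^ 'n ^ ('m \<times> 'n)"
  where "diag_stack G = (\<chi> p k. if snd p = k then G $ fst p $ k else 0)"

definition column_stochastic :: "real ^ 'n ^ 'm \<Rightarrow> bool"
  where "column_stochastic B \<longleftrightarrow>
    (\<forall>j i. 0 \<le> B $ j $ i) \<and> (\<forall>i. (\<Sum>j\<in>UNIV. B $ j $ i) = 1)"


section \<open>Hidden Markov chains\<close>

definition F_alg ::
    "'a measure \<Rightarrow> (nat \<Rightarrow> 'a \<Rightarrow> real ^ 'n) \<Rightarrow> (nat \<Rightarrow> 'a \<Rightarrow> real ^ 'm) \<Rightarrow> nat \<Rightarrow> 'a measure"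
  where "F_alg M X Y t = join_alg (gen_alg M {..t} X) (gen_alg M {..t} Y)"

definition G_alg ::
    "'a measure \<Rightarrow> (nat \<Rightarrow> 'a \<Rightarrow> real ^ 'n) \<Rightarrow> (nat \<Rightarrow> 'a \<Rightarrow> real ^ 'm) \<Rightarrow> nat \<Rightarrow> 'a measure"
  where "G_alg M X Y t = join_alg (gen_alg M {..t} X) (gen_alg M {..<t} Y)"

definition Sigma_P ::
    "'a measure \<Rightarrow> (nat \<Rightarrow> 'a \<Rightarrow> real ^ 'n) \<Rightarrow> (nat \<Rightarrow> 'a \<Rightarrow> real ^ 'm) \<Rightarrow> bool"
  where "Sigma_P M X Y \<longleftrightarrow>
    (\<forall>t. cond_indep_alg M
       (join_alg (gen_alg M {t + 1..} X) (gen_alg M {t + 1..} Y))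
       (join_alg (gen_alg M {..t} X) (gen_alg M {..t} Y))
       (gen_alg M {t} X))"

definition Sigma_S ::
    "'a measure \<Rightarrow> (nat \<Rightarrow> 'a \<Rightarrow> real ^ 'n) \<Rightarrow> (nat \<Rightarrow> 'a \<Rightarrow> real ^ 'm) \<Rightarrow> bool"
  where "Sigma_S M X Y \<longleftrightarrow>
    (\<forall>t. cond_indep_alg M
       (join_alg (gen_alg M {t..} X) (gen_alg M {t..} Y))
       (join_alg (gen_alg M {..<t} X) (gen_alg M {..<t} Y))
       (gen_alg M {t} X))"

definition Z_proc ::
    "(nat \<Rightarrow> 'a \<Rightarrow> real ^ 'n) \<Rightarrow> (nat \<Rightarrow> 'a \<Rightarrow> real ^ 'm) \<Rightarrow> nat \<Rightarrow> 'a \<Rightarrow> real ^ ('m \<times> 'n)"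
  where "Z_proc X Y t \<omega> = kron (Y t \<omega>) (X t \<omega>)"

text \<open>Only meaningful for \<open>t \<ge> 1\<close>, because of truncated subtraction.\<close>

definition W_proc ::
    "(nat \<Rightarrow> 'a \<Rightarrow> real ^ 'n) \<Rightarrow> (nat \<Rightarrow> 'a \<Rightarrow> real ^ 'm) \<Rightarrow> nat \<Rightarrow> 'a \<Rightarrow> real ^ ('m \<times> 'n)"
  where "W_proc X Y t \<omega> = kron (Y (t - 1) \<omega>) (X t \<omega>)"

definition time_homogeneous ::
    "'a measure \<Rightarrow> (nat \<Rightarrow> 'a \<Rightarrow> real ^ 'n) \<Rightarrow> (nat \<Rightarrow> 'a \<Rightarrow> real ^ 'm) \<Rightarrow> bool"
  where "time_homogeneous M X Y \<longleftrightarrow>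
    (\<exists>(Q :: real ^ 'n ^ ('m \<times> 'n)) (R :: real ^ 'n ^ ('m \<times> 'n)).
       (\<forall>t. AE \<omega> in M.
          vec_cond_exp M (F_alg M X Y t) (Z_proc X Y (t + 1)) \<omega> = Q *v X t \<omega>) \<and>
       (\<forall>t\<ge>1. AE \<omega> in M.
          vec_cond_exp M (G_alg M X Y t) (W_proc X Y (t + 1)) \<omega> = R *v X t \<omega>))"

definition hmc_matrix :: "real ^ 'n ^ 'm \<Rightarrow> real ^ 'n ^ 'n \<Rightarrow> real ^ ('m \<times> 'n) ^ ('m \<times> 'n)"
  where "hmc_matrix G A = diag_stack G ** A ** row_kron (\<chi> j. 1) (mat 1)"

definition hidden_markov_chain ::
    "'a measure \<Rightarrow> (nat \<Rightarrow> 'a \<Rightarrow> real ^ 'n) \<Rightarrow> (nat \<Rightarrow> 'a \<Rightarrow> real ^ 'm) \<Rightarrow> bool"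
  where "hidden_markov_chain M X Y \<longleftrightarrow>
    (\<exists>(A :: real ^ 'n ^ 'n) (G :: real ^ 'n ^ 'm).
       column_stochastic A \<and> column_stochastic G \<and>
       (\<forall>t. AE \<omega> in M.
          vec_cond_exp M (F_alg M X Y t) (Z_proc X Y (t + 1)) \<omega>
            = hmc_matrix G A *v Z_proc X Y t \<omega> \<and>
          hmc_matrix G A *v Z_proc X Y t \<omega> = (diag_stack G ** A) *v X t \<omega>))"

end

theory Submission
  imports Defs
begin

text \<open>
  All conditioning variables are discrete, so each conditional expectation is equivalent to a
  family of identities between probabilities restricted to the atoms \<open>{X\<^sub>t = e\<^sub>k}\<close>.
  For the direct implication, homogeneity of \<open>W\<close> gives \<open>P(Y\<^sub>t = f\<^sub>j | \<G>\<^sub>t) = G\<^sub>j\<^sub>k\<close> on \<open>{X\<^sub>t = e\<^sub>k}\<close>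
  for \<open>t \<ge> 1\<close>, where \<open>G\<close> is a marginal of \<open>R\<close>; combined with the marginal \<open>A\<close> of \<open>Q\<close> this
  factorises the transitions of \<open>Z\<close>. Columns of \<open>A\<close> at states that are never visited, and of \<open>G\<close> at
  states that are not visited at positive times, are arbitrary.
  For the converse, the conditional law of a finite future cylinder given \<open>\<F>\<^sub>t\<close> (for \<open>\<Sigma>\<^sub>P\<close>) or
  \<open>\<G>\<^sub>t\<close> (for \<open>\<Sigma>\<^sub>S\<close>) depends only on the current state of \<open>X\<close>, by induction on its length;
  Dynkin's lemma extends this to the whole future.
\<close>

section \<open>Sub-sigma-algebras\<close>

lemma subalgebra_gen_alg:
  assumes "\<And>t. f t \<in> borel_measurable M"
  shows "subalgebra M (gen_alg M I f)"
proof -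
  have "(\<Union>s\<in>I. {f s -` B \<inter> space M | B. B \<in> sets borel}) \<subseteq> sets M"
    using assms by (auto intro: measurable_sets)
  then show ?thesis
    unfolding subalgebra_def gen_alg_def
    by (auto simp: space_measure_of_conv sets_measure_of_conv dest: sets.sigma_sets_subset)
qed

text \<open>The generators inside \<open>gen_alg\<close>, named separately so that a join of
  histories is generated by a plain union of such sets.\<close>

definition history_gens ::
    "'a measure \<Rightarrow> nat set \<Rightarrow> (nat \<Rightarrow> 'a \<Rightarrow> 'b::topological_space) \<Rightarrow> 'a set set"
  where "history_gens M I f = (\<Union>s\<in>I. {f s -` B \<inter> space M | B. B \<in> sets borel})"

lemma history_gens_Pow: "history_gens M I f \<subseteq> Pow (space M)"
  unfolding history_gens_def by auto

lemma history_gens_Suc: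
  "history_gens M {..Suc t} f = history_gens M {Suc t} f \<union> history_gens M {..t} f"
  unfolding history_gens_def by (simp add: atMost_Suc)

lemma space_gen_alg [simp]: "space (gen_alg M I f) = space M"
  unfolding gen_alg_def by (simp add: space_measure_of_conv)

lemma sets_gen_alg: "sets (gen_alg M I f) = sigma_sets (space M) (history_gens M I f)"
  using history_gens_Pow[of M I f] unfolding gen_alg_def history_gens_def[symmetric]
  by simp

lemma space_join_gen_alg [simp]:
  "space (join_alg (gen_alg M I f) (gen_alg M J g)) = space M"
  unfolding join_alg_def by (simp add: space_measure_of_conv)

lemma sets_join_gen_alg:
  "sets (join_alg (gen_alg M I f) (gen_alg M J g)) =
     sigma_sets (space M) (history_gens M I f \<union> history_gens M J g)"
proof -
  let ?a = "history_gens M I f" and ?b = "history_gens M J g"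
  have "sigma_sets (space M) ?a \<union> sigma_sets (space M) ?b \<subseteq> Pow (space M)"
    by (auto dest: sigma_sets_into_sp[OF history_gens_Pow, THEN subsetD, rotated])
  then have "sets (join_alg (gen_alg M I f) (gen_alg M J g)) =
      sigma_sets (space M) (sigma_sets (space M) ?a \<union> sigma_sets (space M) ?b)"
    unfolding join_alg_def by (simp add: sets_gen_alg)
  also have "\<dots> = sigma_sets (space M) (?a \<union> ?b)"
  proof (rule sigma_sets_eqI)
    fix x assume "x \<in> sigma_sets (space M) ?a \<union> sigma_sets (space M) ?b"
    then show "x \<in> sigma_sets (space M) (?a \<union> ?b)"
      using sigma_sets_mono'[of ?a "?a \<union> ?b"] sigma_sets_mono'[of ?b "?a \<union> ?b"] by blast
  qed auto
  finally show ?thesis .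
qed

lemma sets_join_gen_alg_mono:
  assumes "I \<subseteq> I'" "J \<subseteq> J'"
  shows "sets (join_alg (gen_alg M I f) (gen_alg M J g))
    \<subseteq> sets (join_alg (gen_alg M I' f) (gen_alg M J' g))"
  unfolding sets_join_gen_alg history_gens_def
  by (intro sigma_sets_mono' Un_mono UN_mono assms order_refl)

lemma history_gens_in_join:
  assumes "a \<in> history_gens M I f \<or> a \<in> history_gens M J g"
  shows "a \<in> sets (join_alg (gen_alg M I f) (gen_alg M J g))"
  unfolding sets_join_gen_alg using assms by auto

text \<open>The sets whose trace on \<open>D\<close> is also the trace of a member of
  \<open>C\<close> are closed under complement and countable union, so generators decide. This
  removes from a sigma-algebra whatever is constant on \<open>D\<close>.\<close>

lemma sigma_sets_trace:
  assumes C: "sigma_algebra \<Omega> C"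
    and gens: "\<And>g. g \<in> gs \<Longrightarrow> \<exists>c\<in>C. g \<inter> D = c \<inter> D"
    and "D \<subseteq> \<Omega>" "b \<in> sigma_sets \<Omega> gs"
  shows "\<exists>c\<in>C. b \<inter> D = c \<inter> D"
  using assms(4)
proof induction
  case (Basic a)
  then show ?case by (rule gens)
next
  case Empty
  show ?case using sigma_algebra.sigma_sets_eq[OF C] sigma_sets.Empty by blast
next
  case (Compl a)
  then obtain c where "c \<in> C" "a \<inter> D = c \<inter> D" by blast
  moreover have "\<Omega> - c \<in> C"
    using sigma_algebra.sigma_sets_eq[OF C] sigma_sets.Compl \<open>c \<in> C\<close> by blast
  ultimately show ?case using \<open>D \<subseteq> \<Omega>\<close> by (intro bexI[of _ "\<Omega> - c"]) auto
next
  case (Union a)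
  then obtain c where c: "\<And>i. c i \<in> C" "\<And>i. a i \<inter> D = c i \<inter> D" by metis
  have "(\<Union>i. c i) \<in> C"
    using sigma_algebra.sigma_sets_eq[OF C] sigma_sets.Union[of c \<Omega> C] c(1) by blast
  with c(2) show ?case by (intro bexI[of _ "\<Union>i. c i"]) auto
qed

section \<open>Elementary form of conditional expectations\<close>

definition atom :: "'a measure \<Rightarrow> ('a \<Rightarrow> real ^ 'k) \<Rightarrow> 'k \<Rightarrow> 'a set"
  where "atom M f k = f -` {axis k 1} \<inter> space M"

lemma atom_measurable [measurable]: "f \<in> borel_measurable M \<Longrightarrow> atom M f k \<in> sets M"
  unfolding atom_def by (auto intro: measurable_sets)

lemma atom_subset: "atom M f k \<subseteq> space M"
  unfolding atom_def by auto

lemma atom_disjoint: "k \<noteq> l \<Longrightarrow> atom M f k \<inter> atom M f l = {}"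
  unfolding atom_def by (auto simp: axis_eq_axis)

lemma atom_cover:
  assumes "f \<in> space M \<rightarrow> Basis"
  shows "(\<Union>k. atom M f k) = space M"
proof -
  have "\<exists>k. f \<omega> = axis k 1" if "\<omega> \<in> space M" for \<omega>
    using assms that by (auto simp: Basis_vec_def Pi_iff)
  then show ?thesis unfolding atom_def by auto
qed

text \<open>Turns conditional expectations of unit vectors into conditional probabilities of
  atoms.\<close>

lemma component_eq_indicator:
  assumes "f \<in> space M \<rightarrow> Basis" "\<omega> \<in> space M"
  shows "f \<omega> $ k = indicator (atom M f k) \<omega>"
proof -
  obtain l where "f \<omega> = axis l 1"
    using assms by (auto simp: Basis_vec_def Pi_iff)
  then show ?thesis using assms(2)
    by (auto simp: atom_def indicator_def axis_eq_axis) (auto simp: axis_def)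
qed

context prob_space
begin

lemma prob_atoms:
  assumes "f \<in> borel_measurable M" "f \<in> space M \<rightarrow> Basis" "B \<in> events"
  shows "prob B = (\<Sum>k\<in>UNIV. prob (B \<inter> atom M f k))"
proof -
  have "B = (\<Union>k. B \<inter> atom M f k)"
    using atom_cover[OF assms(2)] sets.sets_into_space[OF assms(3)] by auto
  then have "prob B = prob (\<Union>k. B \<inter> atom M f k)" by simp
  also have "\<dots> = (\<Sum>k\<in>UNIV. prob (B \<inter> atom M f k))"
    using assms atom_disjoint[of _ _ M f]
    by (intro finite_measure_finite_Union) (auto simp: disjoint_family_on_def)
  finally show ?thesis .
qed

lemma subalgebra_sigma_finite:
  "subalgebra M H \<Longrightarrow> sigma_finite_subalgebra M H"
  by (intro finite_measure_subalgebra_is_sigma_finite finite_measure_subalgebra.intro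
    finite_measure_axioms finite_measure_subalgebra_axioms.intro)

text \<open>A conditional expectation is determined by its integrals over the sets of
  \<open>H\<close>. Since the atoms of \<open>x\<close> lie in \<open>H\<close>, these test sets can
  be cut down to one atom, where the candidate is the constant \<open>c k\<close>.\<close>

lemma cond_exp_atoms_iff:
  assumes H: "subalgebra M H" and e: "e \<in> events"
    and f: "\<And>\<omega>. \<omega> \<in> space M \<Longrightarrow> f \<omega> = indicator e \<omega>"
    and [measurable]: "x \<in> borel_measurable M" and x: "x \<in> space M \<rightarrow> Basis"
    and D: "\<And>k. atom M x k \<in> sets H"
  shows "(AE \<omega> in M. real_cond_exp M H f \<omega> = (\<Sum>k\<in>UNIV. c k * x \<omega> $ k)) \<longleftrightarrow>
     (\<forall>b\<in>sets H. \<forall>k. prob (b \<inter> atom M x k \<inter> e) = c k * prob (b \<inter> atom M x k))"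
    (is "?L \<longleftrightarrow> ?R")
proof -
  interpret sigma_finite_subalgebra M H by (rule subalgebra_sigma_finite[OF H])
  let ?g = "\<lambda>\<omega>. \<Sum>k\<in>UNIV. c k * indicator (atom M x k) \<omega> :: real"
  have HM: "b \<in> events" if "b \<in> sets H" for b
    using H that unfolding subalgebra_def by auto
  have [measurable]: "?g \<in> borel_measurable H"
    using D by measurable
  have int_f: "integrable M f"
  proof -
    have "integrable M (indicator e :: 'a \<Rightarrow> real)"
      using e by (simp add: integrable_indicator_iff less_top[symmetric])
    then show ?thesis by (subst Bochner_Integration.integrable_cong[OF refl f])
  qed
  have int_g: "integrable M ?g"
    by (intro Bochner_Integration.integrable_sum integrable_mult_right)
      (simp add: integrable_indicator_iff less_top[symmetric])
  have L_eq: "?L \<longleftrightarrow> (AE \<omega> in M. real_cond_exp M H f \<omega> = ?g \<omega>)"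
    by (intro AE_cong) (simp add: component_eq_indicator[OF x])
  have set_f: "(\<integral>\<omega>\<in>b. f \<omega> \<partial>M) = prob (b \<inter> e)" if "b \<in> sets H" for b
  proof -
    have "(\<integral>\<omega>\<in>b. f \<omega> \<partial>M) = (\<integral>\<omega>. indicator (b \<inter> e) \<omega> \<partial>M)"
      unfolding set_lebesgue_integral_def
      by (intro Bochner_Integration.integral_cong) (auto simp: f indicator_def)
    then show ?thesis using HM[OF that] e by (simp add: Int_absorb2 sets.sets_into_space)
  qed
  have set_g: "(\<integral>\<omega>\<in>b. ?g \<omega> \<partial>M) = (\<Sum>k\<in>UNIV. c k * prob (b \<inter> atom M x k))"
    if "b \<in> sets H" for b
  proof -
    have [measurable]: "b \<in> events" by (rule HM[OF that])
    have "(\<integral>\<omega>\<in>b. ?g \<omega> \<partial>M) =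
        (\<integral>\<omega>. (\<Sum>k\<in>UNIV. c k * indicator (b \<inter> atom M x k) \<omega>) \<partial>M)"
      unfolding set_lebesgue_integral_def
      by (intro Bochner_Integration.integral_cong)
        (auto simp: indicator_def sum_distrib_left intro!: sum.cong)
    also have "\<dots> = (\<Sum>k\<in>UNIV. c k * prob (b \<inter> atom M x k))"
      by (subst Bochner_Integration.integral_sum)
        (auto simp: integrable_indicator_iff less_top[symmetric] Int_absorb2 atom_subset le_infI2)
    finally show ?thesis .
  qed
  show ?thesis
  proof
    assume ?L
    then have AE: "AE \<omega> in M. real_cond_exp M H f \<omega> = ?g \<omega>" using L_eq by simp
    have eq: "prob (b \<inter> e) = (\<Sum>k\<in>UNIV. c k * prob (b \<inter> atom M x k))" if b: "b \<in> sets H" for b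
    proof -
      have [measurable]: "b \<in> events" by (rule HM[OF b])
      have "prob (b \<inter> e) = (\<integral>\<omega>\<in>b. real_cond_exp M H f \<omega> \<partial>M)"
        using real_cond_exp_intA[OF int_f b] set_f[OF b] by simp
      also have "\<dots> = (\<integral>\<omega>\<in>b. ?g \<omega> \<partial>M)"
        unfolding set_lebesgue_integral_def
      proof (rule integral_cong_AE)
        show "AE \<omega> in M. indicator b \<omega> *\<^sub>R real_cond_exp M H f \<omega> = indicator b \<omega> *\<^sub>R ?g \<omega>"
          using AE by eventually_elim simp
      qed measurable
      finally show ?thesis using set_g[OF b] by simp
    qed
    show ?R
    proof (intro ballI allI)
      fix b k assume "b \<in> sets H"
      then have b: "b \<inter> atom M x k \<in> sets H" using D by auto
      \<comment> \<open>Testing on a set inside one atom leaves a single summand, by disjointness of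
        the atoms.\<close>
      have "c l * prob (b \<inter> atom M x k \<inter> atom M x l) =
          (if l = k then c k * prob (b \<inter> atom M x k) else 0)" for l
        using atom_disjoint[of k l M x] by (auto simp: Int_assoc)
      then show "prob (b \<inter> atom M x k \<inter> e) = c k * prob (b \<inter> atom M x k)"
        using eq[OF b] by simp
    qed
  next
    assume R: ?R
    have "AE \<omega> in M. real_cond_exp M H f \<omega> = ?g \<omega>"
    proof (rule real_cond_exp_charact[OF _ int_f int_g])
      fix b assume b: "b \<in> sets H"
      \<comment> \<open>Conversely, summing the identities over all atoms recovers the integral over
        \<open>b\<close>.\<close>
      have "prob (b \<inter> e) = (\<Sum>k\<in>UNIV. prob (b \<inter> e \<inter> atom M x k))"
        using HM[OF b] e x by (intro prob_atoms) auto
      also have "\<dots> = (\<Sum>k\<in>UNIV. c k * prob (b \<inter> atom M x k))"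
        using R b by (intro sum.cong) (auto simp: Int_ac)
      finally show "(\<integral>\<omega>\<in>b. f \<omega> \<partial>M) = (\<integral>\<omega>\<in>b. ?g \<omega> \<partial>M)"
        using set_f[OF b] set_g[OF b] by simp
    qed measurable
    then show ?L using L_eq by simp
  qed
qed

text \<open>Each entry of the Kronecker product is the indicator of an intersection of two atoms.
  There are finitely many entries, so the almost sure identity of vectors splits into scalar
  ones.\<close>

lemma vec_cond_exp_kron_iff:
  fixes Q :: "real ^ ('n :: finite) ^ (('m :: finite) \<times> 'n)"
    and v :: "'a \<Rightarrow> real ^ 'm" and w x :: "'a \<Rightarrow> real ^ 'n"
  assumes H: "subalgebra M H"
    and [measurable]: "x \<in> borel_measurable M" "v \<in> borel_measurable M" "w \<in> borel_measurable M"
    and x: "x \<in> space M \<rightarrow> Basis" and v: "v \<in> space M \<rightarrow> Basis" and w: "w \<in> space M \<rightarrow> Basis"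
    and D: "\<And>k. atom M x k \<in> sets H"
  shows "(AE \<omega> in M. vec_cond_exp M H (\<lambda>\<omega>. kron (v \<omega>) (w \<omega>)) \<omega> = Q *v x \<omega>) \<longleftrightarrow>
    (\<forall>b\<in>sets H. \<forall>j i k. prob (b \<inter> atom M x k \<inter> (atom M v j \<inter> atom M w i)) =
        Q $ (j, i) $ k * prob (b \<inter> atom M x k))"
proof -
  have "(AE \<omega> in M. vec_cond_exp M H (\<lambda>\<omega>. kron (v \<omega>) (w \<omega>)) \<omega> = Q *v x \<omega>) \<longleftrightarrow>
     (AE \<omega> in M. \<forall>p\<in>UNIV. real_cond_exp M H (\<lambda>\<omega>. v \<omega> $ fst p * w \<omega> $ snd p) \<omega> =
        (\<Sum>k\<in>UNIV. Q $ p $ k * x \<omega> $ k))"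
    by (simp add: vec_eq_iff vec_cond_exp_def kron_def matrix_vector_mult_def)
  also have "\<dots> \<longleftrightarrow> (\<forall>p. AE \<omega> in M. real_cond_exp M H (\<lambda>\<omega>. v \<omega> $ fst p * w \<omega> $ snd p) \<omega> =
        (\<Sum>k\<in>UNIV. Q $ p $ k * x \<omega> $ k))"
    by (subst AE_finite_all) auto
  also have "\<dots> \<longleftrightarrow> (\<forall>p. \<forall>b\<in>sets H. \<forall>k.
      prob (b \<inter> atom M x k \<inter> (atom M v (fst p) \<inter> atom M w (snd p))) =
        Q $ p $ k * prob (b \<inter> atom M x k))"
    by (intro all_cong1 cond_exp_atoms_iff[OF H])
      (auto simp: component_eq_indicator[OF v] component_eq_indicator[OF w] indicator_def x D)
  also have "\<dots> \<longleftrightarrow> (\<forall>b\<in>sets H. \<forall>j i k.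
      prob (b \<inter> atom M x k \<inter> (atom M v j \<inter> atom M w i)) =
        Q $ (j, i) $ k * prob (b \<inter> atom M x k))"
    by auto
  finally show ?thesis .
qed


lemma prob_eq_0_subset: "prob A = 0 \<Longrightarrow> A \<in> events \<Longrightarrow> B \<subseteq> A \<Longrightarrow> prob B = 0"
  using finite_measure_mono[of B A] measure_nonneg[of M B] by linarith

end

section \<open>Pairs of processes of unit vectors\<close>

text \<open>The state spaces E and F appear as \<open>Basis\<close>, whose elements in
  \<open>real ^ 'k\<close> are the vectors \<open>axis k 1\<close>.\<close>

locale unit_vector_processes = prob_space M
  for M :: "'a measure"
    and X :: "nat \<Rightarrow> 'a \<Rightarrow> real ^ ('n :: finite)"
    and Y :: "nat \<Rightarrow> 'a \<Rightarrow> real ^ ('m :: finite)" +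
  assumes X_measurable [measurable]: "\<And>t. X t \<in> borel_measurable M"
    and Y_measurable [measurable]: "\<And>t. Y t \<in> borel_measurable M"
    and X_Basis: "\<And>t. X t \<in> space M \<rightarrow> Basis"
    and Y_Basis: "\<And>t. Y t \<in> space M \<rightarrow> Basis"
begin

abbreviation "XA t \<equiv> atom M (X t)"
abbreviation "YA t \<equiv> atom M (Y t)"
abbreviation "FS t \<equiv> sets (F_alg M X Y t)"
abbreviation "GS t \<equiv> sets (G_alg M X Y t)"

lemma subalgebra_join:
  "subalgebra M (join_alg (gen_alg M I X) (gen_alg M J Y))"
proof -
  have "history_gens M I X \<union> history_gens M J Y \<subseteq> events"
    unfolding history_gens_def 
    by (auto intro: measurable_sets[OF X_measurable] measurable_sets[OF Y_measurable])
  from sets.sigma_sets_subset[OF this] show ?thesis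
    unfolding subalgebra_def sets_join_gen_alg by simp
qed

lemma subalgebra_F: "subalgebra M (F_alg M X Y t)"
  unfolding F_alg_def by (rule subalgebra_join)

lemma subalgebra_G: "subalgebra M (G_alg M X Y t)"
  unfolding G_alg_def by (rule subalgebra_join)

lemma FS_events: "b \<in> FS t \<Longrightarrow> b \<in> events"
  using subalgebra_F by (auto simp: subalgebra_def)

lemma GS_events: "b \<in> GS t \<Longrightarrow> b \<in> events"
  using subalgebra_G by (auto simp: subalgebra_def)

lemma space_in_FS: "space M \<in> FS t"
  using subalgebra_F[of t] sets.top[of "F_alg M X Y t"] by (simp add: subalgebra_def)

lemma space_in_GS: "space M \<in> GS t"
  using subalgebra_G[of t] sets.top[of "G_alg M X Y t"] by (simp add: subalgebra_def)

lemma XA_gens: "t \<in> I \<Longrightarrow> XA t k \<in> history_gens M I X"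
  unfolding history_gens_def atom_def by (auto intro!: bexI[of _ t] exI[of _ "{axis k 1}"])

lemma YA_gens: "t \<in> I \<Longrightarrow> YA t k \<in> history_gens M I Y"
  unfolding history_gens_def atom_def by (auto intro!: bexI[of _ t] exI[of _ "{axis k 1}"])

lemma XA_in_FS: "XA t k \<in> FS t"
  unfolding F_alg_def using XA_gens by (intro history_gens_in_join) blast

lemma YA_in_FS: "YA t k \<in> FS t"
  unfolding F_alg_def using YA_gens by (intro history_gens_in_join) blast

lemma XA_in_GS: "XA t k \<in> GS t"
  unfolding G_alg_def using XA_gens by (intro history_gens_in_join) blast

lemma GS_subset_FS: "GS t \<subseteq> FS t"
  unfolding F_alg_def G_alg_def by (intro sets_join_gen_alg_mono) auto

lemma FS_subset_GS_Suc: "FS t \<subseteq> GS (Suc t)"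
  unfolding F_alg_def G_alg_def by (intro sets_join_gen_alg_mono) auto

section \<open>Reduction of sigma-algebras to atoms of the current state\<close>

lemma X_event_on_atom:
  assumes "g \<in> history_gens M {t} X"
  shows "g \<inter> XA t k = {} \<or> g \<inter> XA t k = XA t k"
  using assms unfolding history_gens_def atom_def by auto

text \<open>Beyond \<open>FS t\<close>, the only new information in \<open>GS (Suc t)\<close> is
  \<open>X (Suc t)\<close>, which is constant on the atom.\<close>

lemma GS_Suc_on_atom:
  assumes "b \<in> GS (Suc t)"
  shows "\<exists>b'\<in>FS t. b \<inter> XA (Suc t) k = b' \<inter> XA (Suc t) k"
proof (rule sigma_sets_trace)
  show "sigma_algebra (space M) (FS t)"
    using sets.sigma_algebra_axioms[of "F_alg M X Y t"] subalgebra_F[of t]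
    by (simp add: subalgebra_def)
  show "b \<in> sigma_sets (space M) (history_gens M {..Suc t} X \<union> history_gens M {..<Suc t} Y)"
    using assms unfolding G_alg_def sets_join_gen_alg .
  show "XA (Suc t) k \<subseteq> space M" by (rule atom_subset)
  fix g assume "g \<in> history_gens M {..Suc t} X \<union> history_gens M {..<Suc t} Y"
  then consider "g \<in> history_gens M {..t} X" | "g \<in> history_gens M {..t} Y"
    | "g \<in> history_gens M {Suc t} X"
    unfolding lessThan_Suc_atMost history_gens_Suc by blast
  then show "\<exists>b'\<in>FS t. g \<inter> XA (Suc t) k = b' \<inter> XA (Suc t) k"
  proof cases
    case 1
    then have "g \<in> FS t" unfolding F_alg_def by (intro history_gens_in_join) blast
    then show ?thesis by blast
  next
    case 2
    then have "g \<in> FS t" unfolding F_alg_def by (intro history_gens_in_join) blast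
    then show ?thesis by blast
  next
    case 3
    then consider "g \<inter> XA (Suc t) k = {}" | "g \<inter> XA (Suc t) k = XA (Suc t) k"
      using X_event_on_atom by blast
    then show ?thesis
    proof cases
      case 1
      then show ?thesis by (intro bexI[of _ "{}"]) auto
    next
      case 2
      then show ?thesis using space_in_FS[of t] atom_subset[of M "X (Suc t)" k]
        by (intro bexI[of _ "space M"]) auto
    qed
  qed
qed

text \<open>Given \<open>X t\<close>, the conditional probability of an event on an atom is a
  quotient of two probabilities, so conditional independence is a product rule on each atom.
  Clearing denominators makes that rule meaningful on null atoms too.\<close>

lemma cond_indep_algI:
  assumes sub: "subalgebra M P" "subalgebra M B"
    and prod: "\<And>a b k. a \<in> sets P \<Longrightarrow> b \<in> sets B \<Longrightarrow>
      prob (a \<inter> b \<inter> XA t k) * prob (XA t k) = prob (a \<inter> XA t k) * prob (b \<inter> XA t k)"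
  shows "cond_indep_alg M P B (gen_alg M {t} X)"
proof -
  let ?H = "gen_alg M {t} X"
  have H: "subalgebra M ?H" by (rule subalgebra_gen_alg) simp
  have XA_H: "XA t k \<in> sets ?H" for k
    unfolding sets_gen_alg using XA_gens by auto
  \<comment> \<open>The sigma-algebra of \<open>X t\<close> has only trivial traces on an atom, by
    comparison with the trivial sigma-algebra.\<close>
  have H_trivial: "b \<inter> XA t k = {} \<or> b \<inter> XA t k = XA t k" if "b \<in> sets ?H" for b k
  proof -
    have "\<exists>c\<in>{{}, space M}. b \<inter> XA t k = c \<inter> XA t k"
    proof (rule sigma_sets_trace[OF sigma_algebra_trivial _ atom_subset])
      show "b \<in> sigma_sets (space M) (history_gens M {t} X)"
        using that unfolding sets_gen_alg .
      show "\<exists>c\<in>{{}, space M}. g \<inter> XA t k = c \<inter> XA t k"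
        if "g \<in> history_gens M {t} X" for g
        using X_event_on_atom[OF that, of k] atom_subset[of M "X t" k] by auto
    qed
    then show ?thesis using atom_subset[of M "X t" k] by auto
  qed
  have ce: "AE \<omega> in M. real_cond_exp M ?H (indicator e) \<omega> =
      (\<Sum>k\<in>UNIV. (prob (e \<inter> XA t k) / prob (XA t k)) * X t \<omega> $ k)" if e: "e \<in> events" for e
  proof -
    have "prob (b \<inter> XA t k \<inter> e) = prob (e \<inter> XA t k) / prob (XA t k) * prob (b \<inter> XA t k)"
      if "b \<in> sets ?H" for b k
    proof (cases "b \<inter> XA t k = {}")
      case False
      then have *: "b \<inter> XA t k = XA t k" using H_trivial[OF that] by blast
      show ?thesis
        unfolding * using prob_eq_0_subset[of "XA t k" "e \<inter> XA t k"]
        \<comment> \<open>On a null atom the quotient is 0 by convention and both sides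
          vanish.\<close>
        by (cases "prob (XA t k) = 0") (auto simp: Int_commute)
    qed simp
    then show ?thesis
      by (subst cond_exp_atoms_iff[OF H e refl X_measurable X_Basis XA_H]) simp
  qed
  show ?thesis unfolding cond_indep_alg_def
  proof (intro ballI)
    fix a b assume ab: "a \<in> sets P" "b \<in> sets B"
    then have ev: "a \<in> events" "b \<in> events" using sub by (auto simp: subalgebra_def)
    then have "a \<inter> b \<in> events" by auto
    from ce[OF this] ce[OF ev(1)] ce[OF ev(2)] AE_space
    show "AE \<omega> in M. real_cond_exp M ?H (indicator (a \<inter> b)) \<omega> =
        real_cond_exp M ?H (indicator a) \<omega> * real_cond_exp M ?H (indicator b) \<omega>"
    proof eventually_elim
      case (elim \<omega>)
      obtain l where l: "X t \<omega> = axis l 1"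
        using X_Basis[of t] elim(4) by (auto simp: Basis_vec_def Pi_iff)
      have sum: "(\<Sum>k\<in>UNIV. c k * X t \<omega> $ k) = c l" for c
        unfolding l by (simp add: axis_def if_distrib cong: if_cong)
      \<comment> \<open>The product rule divided by the square of the probability of the atom; if
        that probability is 0, all quotients are 0.\<close>
      have "prob (a \<inter> b \<inter> XA t l) / prob (XA t l) =
          prob (a \<inter> XA t l) / prob (XA t l) * (prob (b \<inter> XA t l) / prob (XA t l))"
        unfolding times_divide_times_eq prod[OF ab, symmetric] by simp
      then show ?case using elim(1-3) unfolding sum by simp
    qed
  qed
qed

section \<open>Elementary transition probabilities\<close>

definition Z_kernel :: "('m \<Rightarrow> 'n \<Rightarrow> 'n \<Rightarrow> real) \<Rightarrow> bool"
  where "Z_kernel q \<longleftrightarrow> (\<forall>t. \<forall>b\<in>FS t. \<forall>j i k.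
    prob (b \<inter> XA t k \<inter> (YA (Suc t) j \<inter> XA (Suc t) i)) = q j i k * prob (b \<inter> XA t k))"

text \<open>W at time t + 1 pairs the emission at t with the state at t + 1, hence
  \<open>YA t\<close> beside \<open>XA (Suc t)\<close>. Starting at 1 leaves the law of the initial
  emission free.\<close>

definition W_kernel :: "('m \<Rightarrow> 'n \<Rightarrow> 'n \<Rightarrow> real) \<Rightarrow> bool"
  where "W_kernel r \<longleftrightarrow> (\<forall>t\<ge>1. \<forall>b\<in>GS t. \<forall>j i k.
    prob (b \<inter> XA t k \<inter> (YA t j \<inter> XA (Suc t) i)) = r j i k * prob (b \<inter> XA t k))"

lemma Z_kernel_iff:
  "(\<forall>t. AE \<omega> in M. vec_cond_exp M (F_alg M X Y t) (Z_proc X Y (t + 1)) \<omega> = Q *v X t \<omega>)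
    \<longleftrightarrow> Z_kernel (\<lambda>j i k. Q $ (j, i) $ k)"
  unfolding Z_kernel_def Z_proc_def[abs_def]
  by (intro all_cong1, subst vec_cond_exp_kron_iff[OF subalgebra_F])
    (simp_all add: X_Basis Y_Basis XA_in_FS)

lemma W_kernel_iff:
  "(\<forall>t\<ge>1. AE \<omega> in M. vec_cond_exp M (G_alg M X Y t) (W_proc X Y (t + 1)) \<omega> = R *v X t \<omega>)
    \<longleftrightarrow> W_kernel (\<lambda>j i k. R $ (j, i) $ k)"
  unfolding W_kernel_def W_proc_def[abs_def]
  by (intro all_cong1 imp_cong refl, subst vec_cond_exp_kron_iff[OF subalgebra_G])
    (simp_all add: X_Basis Y_Basis XA_in_GS)

lemma time_homogeneous_iff:
  "time_homogeneous M X Y \<longleftrightarrow> (\<exists>q r. Z_kernel q \<and> W_kernel r)"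
proof
  assume "time_homogeneous M X Y"
  then show "\<exists>q r. Z_kernel q \<and> W_kernel r"
    unfolding time_homogeneous_def Z_kernel_iff W_kernel_iff by blast
next
  assume "\<exists>q r. Z_kernel q \<and> W_kernel r"
  then obtain q r where *: "Z_kernel q" "W_kernel r" by blast
  let ?mat = "\<lambda>q. (\<chi> p k. q (fst p) (snd p) k) :: real ^ 'n ^ ('m \<times> 'n)"
  have "(\<lambda>j i k. ?mat p $ (j, i) $ k) = p" for p
    by (intro ext) simp
  then have "Z_kernel (\<lambda>j i k. ?mat q $ (j, i) $ k) \<and> W_kernel (\<lambda>j i k. ?mat r $ (j, i) $ k)"
    using * by simp
  then show "time_homogeneous M X Y"
    unfolding time_homogeneous_def Z_kernel_iff W_kernel_iff by blast
qed

section \<open>The hidden Markov matrix in coordinates\<close>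

lemma diag_stack_mult_nth:
  "(diag_stack G ** A) $ (j, i) $ k = G $ j $ i * (A :: real ^ 'n ^ 'n) $ i $ k"
proof -
  have "(diag_stack G ** A) $ (j, i) $ k = (\<Sum>l\<in>UNIV. if i = l then G $ j $ l * A $ l $ k else 0)"
    by (simp add: matrix_matrix_mult_def diag_stack_def if_distrib[of "\<lambda>u. u * _"] cong: if_cong)
  then show ?thesis by simp
qed

text \<open>The block row of identity matrices adds up the blocks of \<open>Z_proc\<close>; the
  entries of the unit vector \<open>Y t\<close> sum to one, so X remains.\<close>

lemma row_kron_Z:
  assumes "\<omega> \<in> space M"
  shows "row_kron (\<chi> j. 1) (mat 1) *v Z_proc X Y t \<omega> = X t \<omega>"
proof -
  obtain j where j: "Y t \<omega> = axis j 1"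
    using Y_Basis[of t] assms by (auto simp: Basis_vec_def Pi_iff)
  have "(\<Sum>p\<in>UNIV. (row_kron (\<chi> j. 1) (mat 1) :: real ^ ('m \<times> 'n) ^ 'n) $ i $ p
      * Z_proc X Y t \<omega> $ p) = X t \<omega> $ i" for i
  proof -
    have "(\<Sum>p\<in>UNIV. (row_kron (\<chi> j. 1) (mat 1) :: real ^ ('m \<times> 'n) ^ 'n) $ i $ p
        * Z_proc X Y t \<omega> $ p) =
        (\<Sum>p\<in>UNIV \<times> UNIV. if p = (j, i) then X t \<omega> $ i else 0)"
      by (intro sum.cong) (auto simp: row_kron_def mat_def Z_proc_def kron_def j axis_def)
    then show ?thesis by simp
  qed
  then show ?thesis by (simp add: vec_eq_iff matrix_vector_mult_def)
qed

text \<open>By \<open>row_kron_Z\<close>, Q applied to Z equals the matrix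
  \<open>diag_stack G ** A\<close> applied to X at every point, so the definition becomes one kernel
  identity with factorised entries.\<close>

lemma hidden_markov_chain_iff:
  "hidden_markov_chain M X Y \<longleftrightarrow>
    (\<exists>(A :: real ^ 'n ^ 'n) (G :: real ^ 'n ^ 'm). column_stochastic A \<and> column_stochastic G \<and>
      Z_kernel (\<lambda>j i k. G $ j $ i * A $ i $ k))"
proof -
  have "(\<forall>t. AE \<omega> in M.
          vec_cond_exp M (F_alg M X Y t) (Z_proc X Y (t + 1)) \<omega>
            = hmc_matrix G A *v Z_proc X Y t \<omega> \<and>
          hmc_matrix G A *v Z_proc X Y t \<omega> = (diag_stack G ** A) *v X t \<omega>) \<longleftrightarrow>
      Z_kernel (\<lambda>j i k. G $ j $ i * A $ i $ k)"
    for A :: "real ^ 'n ^ 'n" and G :: "real ^ 'n ^ 'm"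
  proof -
    have "hmc_matrix G A *v Z_proc X Y t \<omega> = (diag_stack G ** A) *v X t \<omega>"
      if "\<omega> \<in> space M" for t \<omega>
      unfolding hmc_matrix_def by (simp flip: matrix_vector_mul_assoc add: row_kron_Z[OF that])
    then show ?thesis
      unfolding diag_stack_mult_nth[symmetric] Z_kernel_iff[symmetric]
      by (intro all_cong1 AE_cong) auto
  qed
  then show ?thesis unfolding hidden_markov_chain_def by simp
qed

section \<open>Homogeneous pairs are hidden Markov chains\<close>

lemma prob_sum_Y:
  assumes "B \<in> events" "C \<in> events"
  shows "prob (B \<inter> C) = (\<Sum>j\<in>UNIV. prob (B \<inter> (YA t j \<inter> C)))"
  using prob_atoms[OF Y_measurable Y_Basis, of "B \<inter> C" t] assms by (simp add: Int_ac)

lemma prob_sum_X: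
  assumes "B \<in> events" "C \<in> events"
  shows "prob (B \<inter> C) = (\<Sum>i\<in>UNIV. prob (B \<inter> (C \<inter> XA t i)))"
  using prob_atoms[OF X_measurable X_Basis, of "B \<inter> C" t] assms by (simp add: Int_ac)

lemma prob_sum_X':
  assumes "B \<in> events"
  shows "prob B = (\<Sum>i\<in>UNIV. prob (B \<inter> XA t i))"
  using prob_atoms[OF X_measurable X_Basis] assms by simp

theorem time_homogeneous_imp_hidden_markov_chain:
  assumes "time_homogeneous M X Y"
  shows "hidden_markov_chain M X Y"
proof -
  obtain q r where q: "Z_kernel q" and r: "W_kernel r"
    using assms time_homogeneous_iff by blast
  \<comment> \<open>Summing \<open>q\<close> over emissions gives the transition matrix of X. At a
    state that is almost surely never visited \<open>q\<close> is unconstrained, and the identity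
    column is taken instead.\<close>
  define A :: "real ^ 'n ^ 'n" where "A = (\<chi> i k.
    if \<exists>t. prob (XA t k) \<noteq> 0 then \<Sum>j\<in>UNIV. q j i k else if i = k then 1 else 0)"
  define j0 :: 'm where "j0 = undefined"
  \<comment> \<open>Summing \<open>r\<close> over next states gives the emission law.
    \<open>W_kernel\<close> starts at time 1, so a state visited at time 0 only also gets the
    default column, the unit vector at \<open>j0\<close>.\<close>
  define G :: "real ^ 'n ^ 'm" where "G = (\<chi> j k.
    if \<exists>t\<ge>1. prob (XA t k) \<noteq> 0 then \<Sum>i\<in>UNIV. r j i k else if j = j0 then 1 else 0)"
  have A: "prob (b \<inter> XA t k \<inter> XA (Suc t) i) = A $ i $ k * prob (b \<inter> XA t k)"
    if b: "b \<in> FS t" and nz: "prob (XA t k) \<noteq> 0" for b t k i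
  proof -
    have "prob (b \<inter> XA t k \<inter> XA (Suc t) i) =
        (\<Sum>j\<in>UNIV. prob (b \<inter> XA t k \<inter> (YA (Suc t) j \<inter> XA (Suc t) i)))"
      using FS_events[OF b] by (intro prob_sum_Y) auto
    also have "\<dots> = (\<Sum>j\<in>UNIV. q j i k * prob (b \<inter> XA t k))"
      using q b unfolding Z_kernel_def by simp
    finally show ?thesis using nz unfolding A_def by (auto simp: sum_distrib_right)
  qed
  have G: "prob (b \<inter> XA t k \<inter> YA t j) = G $ j $ k * prob (b \<inter> XA t k)"
    if b: "b \<in> GS t" and t: "t \<ge> 1" and nz: "prob (XA t k) \<noteq> 0" for b t k j
  proof -
    have "prob (b \<inter> XA t k \<inter> YA t j) =
        (\<Sum>i\<in>UNIV. prob (b \<inter> XA t k \<inter> (YA t j \<inter> XA (Suc t) i)))"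
      using GS_events[OF b] by (intro prob_sum_X) auto
    also have "\<dots> = (\<Sum>i\<in>UNIV. r j i k * prob (b \<inter> XA t k))"
      using r b t unfolding W_kernel_def by simp
    finally show ?thesis using nz t unfolding G_def by (auto simp: sum_distrib_right)
  qed
  have "column_stochastic A"
    unfolding column_stochastic_def
  proof (intro conjI allI)
    fix i k
    show "0 \<le> A $ i $ k"
    proof (cases "\<exists>t. prob (XA t k) \<noteq> 0")
      case True
      then obtain t where t: "prob (XA t k) \<noteq> 0" by blast
      \<comment> \<open>Taking the whole space as past exhibits the entry times a positive number as
        a probability.\<close>
      have "0 \<le> A $ i $ k * prob (space M \<inter> XA t k)"
        by (subst A[OF space_in_FS t, symmetric]) simp
      with t show ?thesis
        using measure_nonneg[of M "XA t k"]
        by (simp add: Int_absorb1 atom_subset zero_le_mult_iff)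
    qed (auto simp: A_def)
  next
    fix k
    show "(\<Sum>i\<in>UNIV. A $ i $ k) = 1"
    proof (cases "\<exists>t. prob (XA t k) \<noteq> 0")
      case True
      then obtain t where t: "prob (XA t k) \<noteq> 0" by blast
      have "prob (XA t k) = (\<Sum>i\<in>UNIV. prob (space M \<inter> XA t k \<inter> XA (Suc t) i))"
        using prob_sum_X'[of "XA t k" "Suc t"] by (simp add: Int_absorb1 atom_subset)
      also have "\<dots> = (\<Sum>i\<in>UNIV. A $ i $ k) * prob (XA t k)"
        unfolding A[OF space_in_FS t] by (simp add: Int_absorb1 atom_subset sum_distrib_right)
      finally show ?thesis using t by simp
    next
      case False
      then have "(\<Sum>i\<in>UNIV. A $ i $ k) = (\<Sum>i\<in>UNIV. if i = k then 1 else 0)"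
        unfolding A_def by (intro sum.cong) auto
      then show ?thesis by simp
    qed
  qed
  moreover have "column_stochastic G"
    unfolding column_stochastic_def
  proof (intro conjI allI)
    fix j k
    show "0 \<le> G $ j $ k"
    proof (cases "\<exists>t\<ge>1. prob (XA t k) \<noteq> 0")
      case True
      then obtain t where t: "t \<ge> 1" "prob (XA t k) \<noteq> 0" by blast
      have "0 \<le> G $ j $ k * prob (space M \<inter> XA t k)"
        by (subst G[OF space_in_GS t, symmetric]) simp
      with t show ?thesis
        using measure_nonneg[of M "XA t k"]
        by (simp add: Int_absorb1 atom_subset zero_le_mult_iff)
    qed (auto simp: G_def)
  next
    fix k
    show "(\<Sum>j\<in>UNIV. G $ j $ k) = 1"
    proof (cases "\<exists>t\<ge>1. prob (XA t k) \<noteq> 0")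
      case True
      then obtain t where t: "t \<ge> 1" "prob (XA t k) \<noteq> 0" by blast
      have "prob (XA t k) = (\<Sum>j\<in>UNIV. prob (space M \<inter> XA t k \<inter> YA t j))"
        using prob_atoms[OF Y_measurable Y_Basis, of "XA t k" t]
        by (simp add: Int_absorb1 atom_subset)
      also have "\<dots> = (\<Sum>j\<in>UNIV. G $ j $ k) * prob (XA t k)"
        unfolding G[OF space_in_GS t] by (simp add: Int_absorb1 atom_subset sum_distrib_right)
      finally show ?thesis using t by simp
    next
      case False
      then have "(\<Sum>j\<in>UNIV. G $ j $ k) = (\<Sum>j\<in>UNIV. if j = j0 then 1 else 0)"
        unfolding G_def by (intro sum.cong) auto
      then show ?thesis by simp
    qed
  qed
  moreover have "Z_kernel (\<lambda>j i k. G $ j $ i * A $ i $ k)"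
    unfolding Z_kernel_def
  proof (intro allI ballI)
    fix t b j i k assume b: "b \<in> FS t"
    note [measurable] = FS_events[OF b]
    show "prob (b \<inter> XA t k \<inter> (YA (Suc t) j \<inter> XA (Suc t) i)) =
        G $ j $ i * A $ i $ k * prob (b \<inter> XA t k)"
    proof (cases "prob (XA t k) = 0")
      case True
      then have "prob (b \<inter> XA t k \<inter> (YA (Suc t) j \<inter> XA (Suc t) i)) = 0" "prob (b \<inter> XA t k) = 0"
        by (auto intro: prob_eq_0_subset)
      then show ?thesis by simp
    next
      case nz: False
      have "prob (b \<inter> XA t k \<inter> (YA (Suc t) j \<inter> XA (Suc t) i)) =
          G $ j $ i * prob (b \<inter> XA t k \<inter> XA (Suc t) i)"
      proof (cases "prob (XA (Suc t) i) = 0")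
        case True
        then have "prob (b \<inter> XA t k \<inter> (YA (Suc t) j \<inter> XA (Suc t) i)) = 0"
          "prob (b \<inter> XA t k \<inter> XA (Suc t) i) = 0"
          by (auto intro: prob_eq_0_subset)
        then show ?thesis by simp
      next
        case False
        \<comment> \<open>Event and state at time t both belong to the past of time t + 1 \<ge> 1,
          so the emission rule applies there and splits off \<open>G\<close>.\<close>
        have "b \<inter> XA t k \<in> GS (Suc t)" using b XA_in_FS FS_subset_GS_Suc by blast
        from G[OF this _ False, of j] show ?thesis by (simp add: Int_ac)
      qed
      then show ?thesis using A[OF b nz] by simp
    qed
  qed
  ultimately show ?thesis unfolding hidden_markov_chain_iff by blast
qed

section \<open>Hidden Markov chains are homogeneous and conditionally independent\<close>

definition cylinder ::
    "nat \<Rightarrow> nat \<Rightarrow> (nat \<Rightarrow> (real ^ 'n) set) \<Rightarrow> (nat \<Rightarrow> (real ^ 'm) set) \<Rightarrow> 'a set"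
  where "cylinder t N U V =
    {\<omega> \<in> space M. \<forall>s\<in>{t..<t + N}. X s \<omega> \<in> U s \<and> Y s \<omega> \<in> V s}"

definition cylinders :: "nat \<Rightarrow> 'a set set"
  where "cylinders t = {cylinder t N U V | N U V.
    (\<forall>s. U s \<in> sets borel) \<and> (\<forall>s. V s \<in> sets borel)}"

lemma cylinder_Suc:
  "cylinder t (Suc N) U V =
    {\<omega> \<in> space M. X t \<omega> \<in> U t \<and> Y t \<omega> \<in> V t} \<inter> cylinder (Suc t) N U V"
proof -
  have "{t..<t + Suc N} = insert t {Suc t..<Suc t + N}" by auto
  then show ?thesis unfolding cylinder_def by auto
qed

lemma cylinder_events [measurable]:
  assumes [measurable]: "\<And>s. U s \<in> sets borel" "\<And>s. V s \<in> sets borel"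
  shows "cylinder t N U V \<in> events"
  unfolding cylinder_def by measurable

lemma Int_stable_cylinders: "Int_stable (cylinders t)"
proof (rule Int_stableI)
  fix a b assume "a \<in> cylinders t" "b \<in> cylinders t"
  then obtain N U V N' U' V'
    where a: "a = cylinder t N U V" and b: "b = cylinder t N' U' V'"
      and m: "\<And>s. U s \<in> sets borel" "\<And>s. V s \<in> sets borel"
        "\<And>s. U' s \<in> sets borel" "\<And>s. V' s \<in> sets borel"
    unfolding cylinders_def by blast
  \<comment> \<open>Beyond its own window each cylinder is padded with \<open>UNIV\<close>, so both
    have the length of the longer one.\<close>
  let ?i = "\<lambda>N s S. if s < t + N then S else UNIV"
  have "a \<inter> b = cylinder t (max N N') (\<lambda>s. ?i N s (U s) \<inter> ?i N' s (U' s))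
      (\<lambda>s. ?i N s (V s) \<inter> ?i N' s (V' s))"
    unfolding a b cylinder_def by auto
  moreover have "\<dots> \<in> cylinders t"
    unfolding cylinders_def using m by (intro CollectI exI conjI[OF refl]) auto
  ultimately show "a \<inter> b \<in> cylinders t" by simp
qed

lemma history_gens_cylinders:
  "history_gens M {t..} X \<union> history_gens M {t..} Y \<subseteq> cylinders t"
proof
  fix a assume "a \<in> history_gens M {t..} X \<union> history_gens M {t..} Y"
  then consider s B where "s \<ge> t" "B \<in> sets borel" "a = X s -` B \<inter> space M"
    | s B where "s \<ge> t" "B \<in> sets borel" "a = Y s -` B \<inter> space M"
    unfolding history_gens_def by auto
  then show "a \<in> cylinders t"
  proof cases
    case 1
    then have "a = cylinder t (Suc (s - t)) (\<lambda>r. if r = s then B else UNIV) (\<lambda>r. UNIV)"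
      unfolding cylinder_def by auto
    then show ?thesis unfolding cylinders_def using 1(2)
      by (intro CollectI exI conjI) auto
  next
    case 2
    then have "a = cylinder t (Suc (s - t)) (\<lambda>r. UNIV) (\<lambda>r. if r = s then B else UNIV)"
      unfolding cylinder_def by auto
    then show ?thesis unfolding cylinders_def using 2(2)
      by (intro CollectI exI conjI) auto
  qed
qed

text \<open>The factor \<phi> is the same for every past event; the whole space as past shows that
  it is the conditional probability of \<open>c\<close> on a non-null atom, which gives the product
  rule for cylinders. Separate times \<open>s\<close> and \<open>t\<close> serve
  \<open>Sigma_P\<close> with s = t + 1 and \<open>Sigma_S\<close> with s = t.\<close>

lemma cond_indep_future:
  assumes B: "subalgebra M B"
    and cyl: "\<And>c k. c \<in> cylinders s \<Longrightarrow>
      \<exists>\<phi>. \<forall>b\<in>sets B. prob (b \<inter> XA t k \<inter> c) = \<phi> * prob (b \<inter> XA t k)"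
  shows "cond_indep_alg M (join_alg (gen_alg M {s..} X) (gen_alg M {s..} Y)) B (gen_alg M {t} X)"
proof (rule cond_indep_algI[OF subalgebra_join B])
  fix a b k
  assume a: "a \<in> sets (join_alg (gen_alg M {s..} X) (gen_alg M {s..} Y))" and b: "b \<in> sets B"
  have b_ev [measurable]: "b \<in> events" using B b by (auto simp: subalgebra_def)
  have space_B: "space M \<in> sets B"
    using B sets.top[of B] by (simp add: subalgebra_def)
  have Pow: "cylinders s \<subseteq> Pow (space M)"
    unfolding cylinders_def cylinder_def by blast
  have ev: "sigma_sets (space M) (cylinders s) \<subseteq> events"
    by (intro sets.sigma_sets_subset) (auto simp: cylinders_def)
  let ?x = "XA t k"
  have "a \<in> sigma_sets (space M) (cylinders s)"
    using a sigma_sets_mono'[OF history_gens_cylinders[of s]] unfolding sets_join_gen_alg by blast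
  from Int_stable_cylinders Pow this
  \<comment> \<open>For fixed \<open>b\<close> both sides are finite measures in \<open>a\<close> of
    equal total mass, so Dynkin's lemma extends their equality from the intersection-stable
    cylinders.\<close>
  show "prob (a \<inter> b \<inter> ?x) * prob ?x = prob (a \<inter> ?x) * prob (b \<inter> ?x)"
  proof (induction rule: sigma_sets_induct_disjoint)
    case (basic c)
    then obtain \<phi> where *: "\<forall>b\<in>sets B. prob (b \<inter> ?x \<inter> c) = \<phi> * prob (b \<inter> ?x)"
      using cyl by blast
    have "prob (c \<inter> b \<inter> ?x) = \<phi> * prob (b \<inter> ?x)"
      using * b by (simp add: Int_ac)
    moreover have "prob (c \<inter> ?x) = \<phi> * prob ?x"
      using *[rule_format, OF space_B] by (simp add: Int_absorb1 atom_subset Int_commute)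
    ultimately show ?case by simp
  next
    case empty
    show ?case by simp
  next
    case (compl c)
    have [measurable]: "c \<in> events" using compl ev by blast
    have diff: "prob ((space M - c) \<inter> D) = prob D - prob (c \<inter> D)" if "D \<in> events" for D
    proof -
      have "(space M - c) \<inter> D = D - c \<inter> D" using sets.sets_into_space[OF that] by auto
      then show ?thesis using that by (simp add: finite_measure_Diff)
    qed
    have "prob ((space M - c) \<inter> b \<inter> ?x) = prob (b \<inter> ?x) - prob (c \<inter> b \<inter> ?x)"
      using diff[of "b \<inter> ?x"] by (simp add: Int_assoc)
    moreover have "prob ((space M - c) \<inter> ?x) = prob ?x - prob (c \<inter> ?x)"
      by (rule diff) simp
    ultimately show ?case
      using compl by (simp only: left_diff_distrib right_diff_distrib mult.commute)
  next
    case (union c)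
    have [measurable]: "c i \<in> events" for i using union ev by blast
    have sums: "(\<lambda>i. prob (c i \<inter> D)) sums prob ((\<Union>i. c i) \<inter> D)" if "D \<in> events" for D
    proof -
      have "(\<lambda>i. prob (c i \<inter> D)) sums prob (\<Union>i. c i \<inter> D)"
        using union(1) that by (intro finite_measure_UNION) (auto simp: disjoint_family_on_def)
      then show ?thesis by simp
    qed
    have "(\<lambda>i. prob (c i \<inter> b \<inter> ?x) * prob ?x) sums (prob ((\<Union>i. c i) \<inter> b \<inter> ?x) * prob ?x)"
      using sums[of "b \<inter> ?x"] by (intro sums_mult2) (simp add: Int_assoc)
    moreover have "(\<lambda>i. prob (c i \<inter> ?x) * prob (b \<inter> ?x)) sums
        (prob ((\<Union>i. c i) \<inter> ?x) * prob (b \<inter> ?x))"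
      using sums[of ?x] by (intro sums_mult2) simp
    ultimately show ?case using union sums_unique2 by simp
  qed
qed

section \<open>One-step laws and cylinder laws of a hidden Markov chain\<close>

context
  fixes A :: "real ^ 'n ^ 'n" and G :: "real ^ 'n ^ 'm"
  assumes G_stoch: "column_stochastic G"
    and Z: "Z_kernel (\<lambda>j i k. G $ j $ i * A $ i $ k)"
begin

text \<open>Summing out the emission leaves \<open>A\<close>, because the columns of
  \<open>G\<close> sum to one.\<close>

lemma transition_X:
  assumes b: "b \<in> FS t"
  shows "prob (b \<inter> XA t k \<inter> XA (Suc t) i) = A $ i $ k * prob (b \<inter> XA t k)"
proof -
  have "prob (b \<inter> XA t k \<inter> XA (Suc t) i) =
      (\<Sum>j\<in>UNIV. prob (b \<inter> XA t k \<inter> (YA (Suc t) j \<inter> XA (Suc t) i)))"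
    using FS_events[OF b] by (intro prob_sum_Y) auto
  also have "\<dots> = (\<Sum>j\<in>UNIV. G $ j $ i) * (A $ i $ k * prob (b \<inter> XA t k))"
    using Z b unfolding Z_kernel_def by (simp add: sum_distrib_right mult.assoc)
  finally show ?thesis using G_stoch unfolding column_stochastic_def by simp
qed

text \<open>On the atom the past may be replaced by one in \<open>FS t\<close>. Splitting by the
  state at t, the joint law of the next pair is \<open>G $ j $ k\<close> times the law of the next
  state; the factor does not involve the earlier state.\<close>

lemma emission_Y:
  assumes b: "b \<in> GS (Suc t)"
  shows "prob (b \<inter> XA (Suc t) k \<inter> YA (Suc t) j) = G $ j $ k * prob (b \<inter> XA (Suc t) k)"
proof -
  obtain b' where b': "b' \<in> FS t" "b \<inter> XA (Suc t) k = b' \<inter> XA (Suc t) k"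
    using GS_Suc_on_atom[OF b] by blast
  note [measurable] = FS_events[OF b'(1)]
  have "prob (b' \<inter> XA (Suc t) k \<inter> YA (Suc t) j) =
      (\<Sum>l\<in>UNIV. prob (b' \<inter> XA (Suc t) k \<inter> YA (Suc t) j \<inter> XA t l))"
    by (intro prob_sum_X') auto
  also have "\<dots> = (\<Sum>l\<in>UNIV. prob (b' \<inter> XA t l \<inter> (YA (Suc t) j \<inter> XA (Suc t) k)))"
    by (simp add: Int_ac)
  also have "\<dots> = (\<Sum>l\<in>UNIV. G $ j $ k * prob (b' \<inter> XA t l \<inter> XA (Suc t) k))"
    using Z b'(1) transition_X[OF b'(1)] unfolding Z_kernel_def by (simp add: mult.assoc)
  also have "\<dots> = G $ j $ k * prob (b' \<inter> XA (Suc t) k)"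
    using prob_sum_X'[of "b' \<inter> XA (Suc t) k" t] by (simp add: sum_distrib_left Int_ac)
  finally show ?thesis using b'(2) by simp
qed

lemma W_kernel_hmc: "W_kernel (\<lambda>j i k. A $ i $ k * G $ j $ k)"
  unfolding W_kernel_def
proof (intro allI ballI impI)
  fix t :: nat and b j i k assume t: "t \<ge> 1" and b: "b \<in> GS t"
  then obtain s where s: "t = Suc s" by (cases t) auto
  \<comment> \<open>The current emission counts as past for the transition of X, and
    \<open>emission_Y\<close> then evaluates it.\<close>
  have "b \<inter> YA t j \<in> FS t" using b GS_subset_FS YA_in_FS by blast
  from transition_X[OF this] have "prob (b \<inter> XA t k \<inter> (YA t j \<inter> XA (Suc t) i)) =
      A $ i $ k * prob (b \<inter> XA t k \<inter> YA t j)"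
    by (simp add: Int_ac)
  then show "prob (b \<inter> XA t k \<inter> (YA t j \<inter> XA (Suc t) i)) =
      A $ i $ k * G $ j $ k * prob (b \<inter> XA t k)"
    using emission_Y b unfolding s by simp
qed

text \<open>Induction on the window length, with time and state arbitrary: the first pair of the
  window is absorbed into the past, and the remaining window depends on that pair through its state
  only.\<close>

lemma cylinder_after_F:
  assumes m: "\<And>s. U s \<in> sets borel" "\<And>s. V s \<in> sets borel"
  shows "\<exists>\<phi>. \<forall>b\<in>FS t. prob (b \<inter> XA t k \<inter> cylinder (Suc t) N U V) = \<phi> * prob (b \<inter> XA t k)"
proof (induction N arbitrary: t k)
  case 0
  have "cylinder (Suc t) 0 U V = space M" by (simp add: cylinder_def)
  then show ?case
    by (intro exI[of _ 1]) (auto simp: Int_absorb2 atom_subset le_infI2)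
next
  case (Suc N)
  let ?C = "\<lambda>t. cylinder (Suc t) N U V"
  note [measurable] = cylinder_events[of U V, OF m]
  obtain \<phi> where \<phi>: "\<And>i b. b \<in> FS (Suc t) \<Longrightarrow>
      prob (b \<inter> XA (Suc t) i \<inter> ?C (Suc t)) = \<phi> i * prob (b \<inter> XA (Suc t) i)"
    using Suc[of "Suc t"] by metis
  \<comment> \<open>One-step weights times the factor of the shorter cylinder, summed over the pairs
    that the first constraint admits.\<close>
  define \<psi> where "\<psi> = (\<Sum>i\<in>UNIV. \<Sum>j\<in>UNIV.
    if axis i 1 \<in> U (Suc t) \<and> axis j 1 \<in> V (Suc t) then \<phi> i * (G $ j $ i * A $ i $ k) else 0)"
  have "prob (b \<inter> XA t k \<inter> cylinder (Suc t) (Suc N) U V) = \<psi> * prob (b \<inter> XA t k)"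
    if b: "b \<in> FS t" for b
  proof -
    note [measurable] = FS_events[OF b]
    let ?D = "b \<inter> XA t k \<inter> cylinder (Suc t) (Suc N) U V"
    have summand: "prob (?D \<inter> XA (Suc t) i \<inter> YA (Suc t) j) =
        (if axis i 1 \<in> U (Suc t) \<and> axis j 1 \<in> V (Suc t)
         then \<phi> i * (G $ j $ i * A $ i $ k) else 0) * prob (b \<inter> XA t k)" for i j
    proof (cases "axis i 1 \<in> U (Suc t) \<and> axis j 1 \<in> V (Suc t)")
      case True
      then have D_eq: "?D \<inter> XA (Suc t) i \<inter> YA (Suc t) j =
          b \<inter> XA t k \<inter> YA (Suc t) j \<inter> XA (Suc t) i \<inter> ?C (Suc t)"
        unfolding cylinder_Suc atom_def by auto
      have past: "b \<inter> XA t k \<inter> YA (Suc t) j \<in> FS (Suc t)"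
        using b XA_in_FS[of t] YA_in_FS[of "Suc t"] FS_subset_GS_Suc[of t] GS_subset_FS[of "Suc t"]
        by blast
      have "prob (?D \<inter> XA (Suc t) i \<inter> YA (Suc t) j) =
          \<phi> i * prob (b \<inter> XA t k \<inter> (YA (Suc t) j \<inter> XA (Suc t) i))"
        unfolding D_eq \<phi>[OF past] by (simp add: Int_assoc)
      then show ?thesis using Z b True unfolding Z_kernel_def by simp
    next
      case False
      then have "?D \<inter> XA (Suc t) i \<inter> YA (Suc t) j = {}"
        unfolding cylinder_Suc atom_def by auto
      then show ?thesis using False by auto
    qed
    have "prob ?D = (\<Sum>i\<in>UNIV. prob (?D \<inter> XA (Suc t) i))"
      using m by (intro prob_sum_X') auto
    also have "\<dots> = (\<Sum>i\<in>UNIV. \<Sum>j\<in>UNIV. prob (?D \<inter> XA (Suc t) i \<inter> YA (Suc t) j))"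
      using m by (intro sum.cong refl prob_atoms Y_measurable Y_Basis) auto
    finally show ?thesis unfolding summand \<psi>_def by (simp add: sum_distrib_right)
  qed
  then show ?case by blast
qed

text \<open>The window now starts at the current time, whose state is known, so only the current
  emission is averaged by \<open>emission_Y\<close> before \<open>cylinder_after_F\<close> takes
  over. The time is positive because \<open>emission_Y\<close> needs a preceding step.\<close>

lemma cylinder_after_G:
  assumes m: "\<And>s. U s \<in> sets borel" "\<And>s. V s \<in> sets borel"
  shows "\<exists>\<phi>. \<forall>b\<in>GS (Suc t).
    prob (b \<inter> XA (Suc t) k \<inter> cylinder (Suc t) N U V) = \<phi> * prob (b \<inter> XA (Suc t) k)"
proof (cases N)
  case 0
  have "cylinder (Suc t) 0 U V = space M" by (simp add: cylinder_def)
  then show ?thesis unfolding 0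
    by (intro exI[of _ 1]) (auto simp: Int_absorb2 atom_subset le_infI2)
next
  case (Suc N')
  let ?t = "Suc t"
  let ?C = "cylinder (Suc ?t) N' U V"
  obtain \<phi> where \<phi>: "\<And>b. b \<in> FS ?t \<Longrightarrow> prob (b \<inter> XA ?t k \<inter> ?C) = \<phi> * prob (b \<inter> XA ?t k)"
    using cylinder_after_F[of U V ?t k N'] m by blast
  define \<psi> where "\<psi> = (\<Sum>j\<in>UNIV.
    if axis k 1 \<in> U ?t \<and> axis j 1 \<in> V ?t then \<phi> * G $ j $ k else 0)"
  have "prob (b \<inter> XA ?t k \<inter> cylinder ?t N U V) = \<psi> * prob (b \<inter> XA ?t k)"
    if b: "b \<in> GS ?t" for b
  proof -
    note [measurable] = GS_events[OF b] cylinder_events[of U V, OF m]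
    let ?D = "b \<inter> XA ?t k \<inter> cylinder ?t N U V"
    have summand: "prob (?D \<inter> YA ?t j) = (if axis k 1 \<in> U ?t \<and> axis j 1 \<in> V ?t
         then \<phi> * G $ j $ k else 0) * prob (b \<inter> XA ?t k)" for j
    proof (cases "axis k 1 \<in> U ?t \<and> axis j 1 \<in> V ?t")
      case True
      then have D_eq: "?D \<inter> YA ?t j = b \<inter> YA ?t j \<inter> XA ?t k \<inter> ?C"
        unfolding Suc cylinder_Suc[of ?t] atom_def by auto
      have "b \<inter> YA ?t j \<in> FS ?t"
        using b YA_in_FS[of ?t] GS_subset_FS[of ?t] by blast
      from \<phi>[OF this] have "prob (?D \<inter> YA ?t j) = \<phi> * prob (b \<inter> XA ?t k \<inter> YA ?t j)"
        unfolding D_eq by (simp add: Int_ac)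
      then show ?thesis using emission_Y[OF b] True by simp
    next
      case False
      then have "?D \<inter> YA ?t j = {}"
        unfolding Suc cylinder_Suc[of ?t] atom_def by auto
      then show ?thesis using False by auto
    qed
    have "prob ?D = (\<Sum>j\<in>UNIV. prob (?D \<inter> YA ?t j))"
      using m by (intro prob_atoms Y_measurable Y_Basis) auto
    then show ?thesis unfolding summand \<psi>_def by (simp add: sum_distrib_right)
  qed
  then show ?thesis by blast
qed

section \<open>The two conditional independence properties\<close>

lemma Sigma_P_hmc: "Sigma_P M X Y"
  unfolding Sigma_P_def
proof (intro allI cond_indep_future subalgebra_join)
  fix t c k assume "c \<in> cylinders (t + 1)"
  then show "\<exists>\<phi>. \<forall>b\<in>sets (join_alg (gen_alg M {..t} X) (gen_alg M {..t} Y)).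
      prob (b \<inter> XA t k \<inter> c) = \<phi> * prob (b \<inter> XA t k)"
    using cylinder_after_F[of _ _ t k] unfolding F_alg_def cylinders_def by auto
qed

lemma Sigma_S_hmc: "Sigma_S M X Y"
  unfolding Sigma_S_def
proof
  fix t
  show "cond_indep_alg M (join_alg (gen_alg M {t..} X) (gen_alg M {t..} Y))
      (join_alg (gen_alg M {..<t} X) (gen_alg M {..<t} Y)) (gen_alg M {t} X)"
  \<comment> \<open>At time 0 the past is trivial and independence is immediate; at positive times
    the past lies in \<open>GS t\<close>, so \<open>cylinder_after_G\<close> applies.\<close>
  proof (cases t)
    case 0
    have past: "b = {} \<or> b = space M"
      if "b \<in> sets (join_alg (gen_alg M {..<t} X) (gen_alg M {..<t} Y))" for b
      using that unfolding 0 sets_join_gen_alg history_gens_def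
      by (simp add: sigma_sets_empty_eq)
    show ?thesis
    proof (rule cond_indep_algI[OF subalgebra_join subalgebra_join])
      fix a b k
      assume a: "a \<in> sets (join_alg (gen_alg M {t..} X) (gen_alg M {t..} Y))"
        and b: "b \<in> sets (join_alg (gen_alg M {..<t} X) (gen_alg M {..<t} Y))"
      have "a \<subseteq> space M" using sets.sets_into_space[OF a] by simp
      with past[OF b] show "prob (a \<inter> b \<inter> XA t k) * prob (XA t k) =
          prob (a \<inter> XA t k) * prob (b \<inter> XA t k)"
        by (auto simp: Int_absorb1 Int_absorb2 atom_subset)
    qed
  next
    case (Suc s)
    have sub: "sets (join_alg (gen_alg M {..<t} X) (gen_alg M {..<t} Y)) \<subseteq> GS t"
      unfolding G_alg_def by (intro sets_join_gen_alg_mono) auto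
    show ?thesis
    proof (intro cond_indep_future subalgebra_join)
      fix c k assume "c \<in> cylinders t"
      then obtain N U V where "c = cylinder t N U V"
        and m: "\<And>s. U s \<in> sets borel" "\<And>s. V s \<in> sets borel"
        unfolding cylinders_def by blast
      with cylinder_after_G[of U V s k N]
      obtain \<phi> where "\<forall>b\<in>GS t. prob (b \<inter> XA t k \<inter> c) = \<phi> * prob (b \<inter> XA t k)"
        unfolding Suc by blast
      then show "\<exists>\<phi>. \<forall>b\<in>sets (join_alg (gen_alg M {..<t} X) (gen_alg M {..<t} Y)).
          prob (b \<inter> XA t k \<inter> c) = \<phi> * prob (b \<inter> XA t k)"
        using sub by blast
    qed
  qed
qed

end

theorem hidden_markov_chain_imp:
  assumes "hidden_markov_chain M X Y"
  shows "time_homogeneous M X Y \<and> Sigma_P M X Y \<and> Sigma_S M X Y"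
proof -
  obtain A :: "real ^ 'n ^ 'n" and G :: "real ^ 'n ^ 'm"
    where G: "column_stochastic G"
      and Z: "Z_kernel (\<lambda>j i k. G $ j $ i * A $ i $ k)"
    using assms hidden_markov_chain_iff by blast
  have "time_homogeneous M X Y"
    unfolding time_homogeneous_iff using Z W_kernel_hmc[OF G Z] by blast
  with Sigma_P_hmc[OF G Z] Sigma_S_hmc[OF G Z] show ?thesis by blast
qed

end

theorem proposition4p3:
  fixes M :: "'a measure"
    and X :: "nat \<Rightarrow> 'a \<Rightarrow> real ^ 'n"
    and Y :: "nat \<Rightarrow> 'a \<Rightarrow> real ^ 'm"
  assumes "prob_space M"
    and "\<And>t. X t \<in> borel_measurable M"
    and "\<And>t. Y t \<in> borel_measurable M"
    and "\<And>t. X t \<in> space M \<rightarrow> Basis"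
    and "\<And>t. Y t \<in> space M \<rightarrow> Basis"
  shows "(time_homogeneous M X Y \<and> Sigma_P M X Y \<and> Sigma_S M X Y
            \<longrightarrow> hidden_markov_chain M X Y)
       \<and> (hidden_markov_chain M X Y
            \<longrightarrow> time_homogeneous M X Y \<and> Sigma_P M X Y \<and> Sigma_S M X Y)"
proof -
  interpret unit_vector_processes M X Y
    using assms unfolding unit_vector_processes_def unit_vector_processes_axioms_def by auto
  show ?thesis
    using time_homogeneous_imp_hidden_markov_chain hidden_markov_chain_imp by blast
qed

end
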